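(* Let $H$ be a finite-dimensional real Hilbert space and let $f:H\to\mathbb{R}$ be convex, twice continuously differentiable and bounded below, with nonempty set of minimizers $X_\star$ and minimal value $f_\star$. Assume that for some $L_\nu>0$ and $\nu\in[0,1]$ one has $\|\nabla^2 f(x)-\nabla^2 f(y)\|\le L_\nu\|x-y\|^\nu$ for all $x,y\in H$, and that $D:=\sup\{\operatorname{dist}(x,X_\star): x\in H,\ f(x)\le f(x_0)\}<\infty$. Let $(x_k)_k$ be the iterates produced by the exact UniCAT trust-region method (described in the context) started at $x_0$ with parameter $\vartheta>0$, and assume $0<\eta_2<\frac{1}{1+\vartheta/2}$. Then $$k_{\mathrm{CAT},\mathrm{cvx}}(\varepsilon):=\min\{k\in\mathbb{N}: f(x_k)-f_\star\le\varepsilon\}=\mathcal{O}\bigl(\varepsilon^{-\frac{1}{1+\nu}}\bigr)\qquad(\varepsilon\downarrow0),$$ that is, there exist constants $C>0$ and $\varepsilon_0>0$, independent of $\varepsilon$ (they may depend on the problem data and the algorithmic parameters), such that $k_{\mathrm{CAT},\mathrm{cvx}}(\varepsilon)\le C\varepsilon^{-1/(1+\nu)}$ for all $\varepsilon\in(0,\varepsilon_0]$.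
   Context: $\mathbb{N}=\{0,1,2,\dots\}$. Write $g_k:=\nabla f(x_k)$, $H_k:=\nabla^2 f(x_k)$ and $m_k(s):=f(x_k)+\langle g_k,s\rangle+\tfrac12\langle H_ks,s\rangle$. Exact UniCAT method. Inputs: $x_0\in H$, $\Delta_0>0$, $\vartheta>0$, constants $0<\eta_1\le\eta_2<1$, $0<\gamma_1\le\gamma_2<1\le\gamma_3$. For $k=0,1,2,\dots$: if $\|g_k\|=0$, terminate and return $x_k$. Otherwise take an exact solution $s_k\in\arg\min_{\|s\|\le\Delta_k}m_k(s)$ and set $$\rho_k^\vartheta:=\frac{f(x_k)-f(x_k+s_k)}{m_k(0)-m_k(s_k)+\frac{\vartheta}{2}\min\{\|\nabla f(x_k)\|,\|\nabla f(x_k+s_k)\|\}\|s_k\|}.$$ Set $x_{k+1}=x_k+s_k$ if $\rho_k^\vartheta\ge\eta_1$ and $x_{k+1}=x_k$ otherwise. Choose $\Delta_{k+1}$ arbitrarily in $[\gamma_1\Delta_k,\gamma_2\Delta_k]$ if $\rho_k^\vartheta<\eta_1$, in $[\gamma_2\Delta_k,\Delta_k]$ if $\eta_1\le\rho_k^\vartheta<\eta_2$, and in $[\Delta_k,\gamma_3\Delta_k]$ if $\rho_k^\vartheta\ge\eta_2$. Standing convention: the method does not terminate finitely, i.e. $\|\nabla f(x_k)\|>0$ and $f(x_k)-f_\star>0$ for all $k\in\mathbb{N}$. *)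

theory Defs
  imports "HOL-Analysis.Analysis"
begin

definition gradient :: "('a::euclidean_space \<Rightarrow> real) \<Rightarrow> 'a \<Rightarrow> 'a" where
  "gradient f x = (THE D. GDERIV f x :> D)"

text \<open>The Hessian is a bounded linear operator, so that the norm on it is the operator norm.\<close>

definition hessian :: "('a::euclidean_space \<Rightarrow> real) \<Rightarrow> 'a \<Rightarrow> 'a \<Rightarrow>\<^sub>L 'a" where
  "hessian f x = Blinfun (frechet_derivative (gradient f) (at x))"

definition twice_cont_diff :: "('a::euclidean_space \<Rightarrow> real) \<Rightarrow> bool" where
  "twice_cont_diff f \<longleftrightarrow>
     (\<forall>x. f differentiable (at x)) \<and>
     (\<forall>x. gradient f differentiable (at x)) \<and>
     continuous_on UNIV (hessian f)"

lemma gradient_eqI: "GDERIV f x :> D \<Longrightarrow> gradient f x = D"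
  unfolding gradient_def
proof (rule the_equality)
  fix E assume "GDERIV f x :> D" "GDERIV f x :> E"
  then have "(\<lambda>h. h \<bullet> D) = (\<lambda>h. h \<bullet> E)"
    unfolding gderiv_def by (rule has_derivative_unique)
  then show "E = D" by (metis vector_eq_ldot)
qed

lemma GDERIV_gradient:
  assumes "f differentiable (at x)"
  shows "GDERIV f x :> gradient f x"
proof -
  obtain f' where f': "(f has_derivative f') (at x)"
    using assms by (auto simp: differentiable_def)
  then have "linear f'" by (rule has_derivative_linear)
  then have "f' = (\<lambda>h. h \<bullet> adjoint f' 1)"
    by (auto simp: adjoint_works fun_eq_iff)
  with f' have "GDERIV f x :> adjoint f' 1" by (simp add: gderiv_def)
  with gradient_eqI show ?thesis by metis
qed

lemma has_derivative_hessian: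
  assumes "gradient f differentiable (at x)"
  shows "(gradient f has_derivative blinfun_apply (hessian f x)) (at x)"
  using assms frechet_derivative_works[of "gradient f" "at x"]
  by (simp add: hessian_def bounded_linear_Blinfun_apply has_derivative_bounded_linear)

definition minimizers :: "('a \<Rightarrow> real) \<Rightarrow> 'a set" where
  "minimizers f = {x. \<forall>y. f x \<le> f y}"

definition min_value :: "('a \<Rightarrow> real) \<Rightarrow> real" where
  "min_value f = (INF x. f x)"

definition model :: "('a::euclidean_space \<Rightarrow> real) \<Rightarrow> 'a \<Rightarrow> 'a \<Rightarrow> real" where
  "model f x s = f x + gradient f x \<bullet> s + 1/2 * (blinfun_apply (hessian f x) s \<bullet> s)"

definition unicat_ratio :: "real \<Rightarrow> ('a::euclidean_space \<Rightarrow> real) \<Rightarrow> 'a \<Rightarrow> 'a \<Rightarrow> real" where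
  "unicat_ratio \<theta> f x s =
     (f x - f (x + s)) /
     (model f x 0 - model f x s
       + \<theta> / 2 * min (norm (gradient f x)) (norm (gradient f (x + s))) * norm s)"

text \<open>
  The sequences \<open>x\<close>, \<open>s\<close>, \<open>\<Delta>\<close> are the iterates, trial steps and radii of a run that is never
  stopped. The method is nondeterministic in the choice of the subproblem solution and of the next
  radius, so a run is described by a relation. The test \<open>gradient f (x k) = 0\<close> does not occur
  here: this definition is to be used together with the assumption that it never succeeds.
\<close>

definition unicat_run ::
  "('a::euclidean_space \<Rightarrow> real) \<Rightarrow> 'a \<Rightarrow> real \<Rightarrow> real \<Rightarrow> real \<Rightarrow> real \<Rightarrow> real \<Rightarrow> real \<Rightarrow> real \<Rightarrow>
    (nat \<Rightarrow> 'a) \<Rightarrow> (nat \<Rightarrow> 'a) \<Rightarrow> (nat \<Rightarrow> real) \<Rightarrow> bool" where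
  "unicat_run f x0 \<Delta>0 \<theta> \<eta>1 \<eta>2 \<gamma>1 \<gamma>2 \<gamma>3 x s \<Delta> \<longleftrightarrow>
     x 0 = x0 \<and> \<Delta> 0 = \<Delta>0 \<and>
     (\<forall>k. let \<rho> = unicat_ratio \<theta> f (x k) (s k) in
        is_arg_min (model f (x k)) (\<lambda>t. norm t \<le> \<Delta> k) (s k) \<and>
        x (Suc k) = (if \<rho> \<ge> \<eta>1 then x k + s k else x k) \<and>
        (\<rho> < \<eta>1 \<longrightarrow> \<Delta> (Suc k) \<in> {\<gamma>1 * \<Delta> k .. \<gamma>2 * \<Delta> k}) \<and>
        (\<eta>1 \<le> \<rho> \<and> \<rho> < \<eta>2 \<longrightarrow> \<Delta> (Suc k) \<in> {\<gamma>2 * \<Delta> k .. \<Delta> k}) \<and>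
        (\<rho> \<ge> \<eta>2 \<longrightarrow> \<Delta> (Suc k) \<in> {\<Delta> k .. \<gamma>3 * \<Delta> k}))"

text \<open>Meaningful only if some iterate reaches accuracy \<open>\<epsilon>\<close>; otherwise \<open>LEAST\<close> is unspecified.\<close>

definition k_cat :: "('a \<Rightarrow> real) \<Rightarrow> (nat \<Rightarrow> 'a) \<Rightarrow> real \<Rightarrow> nat" where
  "k_cat f x \<epsilon> = (LEAST k. f (x k) - min_value f \<le> \<epsilon>)"

end

theory Submission
  imports Defs
begin

text \<open>
  Write \<open>p = 1 / (1 + \<nu>)\<close>, and let \<open>gap\<close> be the difference to the minimal value. By convexity and
  the bound \<open>D\<close> on the level set, \<open>norm (gradient f y)\<close> is at least of order \<open>gap y\<close>, also at
  rejected trial points, where \<open>f\<close> may be large. If the ratio is below \<open>\<eta>2\<close>, then the Taylor error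
  of order \<open>norm s powr (2 + \<nu>)\<close> competes with the model decrease. Hence either
  \<open>norm s powr (1 + \<nu>)\<close> is at least of order \<open>gap\<close> or, when the trial step at least halves the gap,
  \<open>norm s powr (2 + \<nu>)\<close> is. So the radius never falls below order \<open>gap powr p\<close>, each successful
  step decreases \<open>gap\<close> by order \<open>gap powr (1 + p)\<close>, and a potential that adds \<open>gap powr (- p)\<close> to
  the negative logarithm of the radius counts all steps.
\<close>

section \<open>Derivatives along lines and symmetry of the second derivative\<close>

lemma has_derivative_line:
  fixes g :: "'a::real_normed_vector \<Rightarrow> 'b::real_normed_vector"
  assumes "(g has_derivative H) (at (a + t *\<^sub>R v))"
  shows "((\<lambda>t::real. g (a + t *\<^sub>R v)) has_derivative (\<lambda>h. H (h *\<^sub>R v))) (at t)"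
  by (rule has_derivative_compose[where f = "\<lambda>t. a + t *\<^sub>R v", OF _ assms])
    (auto intro!: derivative_eq_intros)

lemma GDERIV_line:
  assumes "GDERIV f (a + t *\<^sub>R v) :> g"
  shows "((\<lambda>t::real. f (a + t *\<^sub>R v)) has_real_derivative g \<bullet> v) (at t)"
  using has_derivative_line[OF assms[unfolded gderiv_def]]
  by (simp add: has_field_derivative_def inner_commute mult_commute_abs)

text \<open>The mean value theorem along \<open>k\<close> turns the second difference into a
  difference of two gradients. When both are linearized at \<open>x\<close>, the contributions of
  \<open>t *\<^sub>R k\<close> cancel and \<open>H h\<close> remains.\<close>

lemma second_difference_bound:
  fixes x h k :: "'a::euclidean_space"
  assumes G: "\<And>y. GDERIV f y :> g y"
    and H: "linear H"
    and d: "\<And>y. norm (y - x) < d \<Longrightarrow> norm (g y - g x - H (y - x)) \<le> e * norm (y - x)"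
    and hk: "norm h + norm k < d" and e: "e > 0"
  shows "\<bar>f (x + h + k) - f (x + h) - f (x + k) + f x - H h \<bullet> k\<bar> \<le> 2 * e * (norm h + norm k)\<^sup>2"
proof -
  define \<psi> where "\<psi> t = f (x + h + t *\<^sub>R k) - f (x + t *\<^sub>R k)" for t :: real
  have D: "(\<psi> has_real_derivative (g (x + h + t *\<^sub>R k) \<bullet> k - g (x + t *\<^sub>R k) \<bullet> k)) (at t)" for t
    unfolding \<psi>_def by (intro DERIV_diff GDERIV_line G)
  obtain t where t: "0 < t" "t < 1"
    and eq: "\<psi> 1 - \<psi> 0 = g (x + h + t *\<^sub>R k) \<bullet> k - g (x + t *\<^sub>R k) \<bullet> k"
    using MVT2[of 0 1 \<psi>, OF _ D] by auto
  define u where "u = g (x + (h + t *\<^sub>R k)) - g x - H (h + t *\<^sub>R k)"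
  define w where "w = g (x + t *\<^sub>R k) - g x - H (t *\<^sub>R k)"
  have tk: "norm (t *\<^sub>R k) \<le> norm k"
    using t by (simp add: mult_left_le_one_le)
  have n1: "norm (h + t *\<^sub>R k) \<le> norm h + norm k"
    using norm_triangle_ineq[of h "t *\<^sub>R k"] tk by linarith
  have n2: "norm (t *\<^sub>R k) \<le> norm h + norm k"
    using tk norm_ge_zero[of h] by linarith
  have u: "norm u \<le> e * (norm h + norm k)"
  proof -
    have "norm u \<le> e * norm (h + t *\<^sub>R k)"
      using d[of "x + (h + t *\<^sub>R k)"] n1 hk by (simp add: u_def)
    also have "\<dots> \<le> e * (norm h + norm k)" using n1 e by (intro mult_left_mono) auto
    finally show ?thesis .
  qed
  have w: "norm w \<le> e * (norm h + norm k)"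
  proof -
    have "norm w \<le> e * norm (t *\<^sub>R k)"
      unfolding w_def using d[of "x + t *\<^sub>R k"] n2 hk by (simp only: add_diff_cancel_left')
    also have "\<dots> \<le> e * (norm h + norm k)" using n2 e by (intro mult_left_mono) auto
    finally show ?thesis .
  qed
  have "g (x + h + t *\<^sub>R k) - g (x + t *\<^sub>R k) = H h + (u - w)"
    by (simp add: u_def w_def linear_add[OF H] algebra_simps)
  then have "f (x + h + k) - f (x + h) - f (x + k) + f x - H h \<bullet> k = (u - w) \<bullet> k"
    using eq by (simp add: \<psi>_def flip: inner_diff_left) (simp add: inner_add_left)
  moreover have "\<bar>(u - w) \<bullet> k\<bar> \<le> (2 * e * (norm h + norm k)) * (norm h + norm k)"
  proof (rule order_trans[OF Cauchy_Schwarz_ineq2], rule mult_mono)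
    show "norm (u - w) \<le> 2 * e * (norm h + norm k)"
      using norm_triangle_ineq4[of u w] u w by linarith
  qed (use e in auto)
  ultimately show ?thesis by (simp add: power2_eq_square mult.assoc)
qed

text \<open>The second difference is symmetric in \<open>h\<close> and \<open>k\<close>, and after
  scaling both vectors by a small \<open>\<tau>\<close> it approximates
  \<open>\<tau>\<^sup>2\<close> times either side of the claim.\<close>

lemma symmetric_second_derivative:
  fixes f :: "'a::euclidean_space \<Rightarrow> real"
  assumes G: "\<And>y. GDERIV f y :> g y" and H: "(g has_derivative H) (at x)"
  shows "H h \<bullet> k = H k \<bullet> h"
proof -
  have lin: "linear H" using H by (rule has_derivative_linear)
  define N where "N = norm h + norm k"
  have N: "N \<ge> 0" by (simp add: N_def)
  have "\<bar>H h \<bullet> k - H k \<bullet> h\<bar> \<le> 0 + \<epsilon>" if "\<epsilon> > 0" for \<epsilon> :: real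
  proof -
    \<comment> \<open>The two errors sum to \<open>4 * e * N\<^sup>2\<close> after division by
      \<open>\<tau>\<^sup>2\<close>, and this choice keeps the sum below \<open>\<epsilon>\<close>.
      The added 1 covers \<open>N = 0\<close>.\<close>
    define e where "e = \<epsilon> / (N\<^sup>2 + 1) / 4"
    have e: "e > 0" using that by (simp add: e_def add_nonneg_pos)
    obtain d where d: "d > 0" "\<And>y. norm (y - x) < d \<Longrightarrow> norm (g y - g x - H (y - x)) \<le> e * norm (y - x)"
      using H e unfolding has_derivative_at_alt by blast
    define \<tau> where "\<tau> = d / (N + 1)"
    have \<tau>: "\<tau> > 0" using d N by (simp add: \<tau>_def)
    have \<tau>N: "\<tau> * N < d"
      using d N by (simp add: \<tau>_def field_simps)
    have sm: "norm (\<tau> *\<^sub>R h) + norm (\<tau> *\<^sub>R k) = \<tau> * N"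
      using \<tau> by (simp add: N_def distrib_left)
    define R where "R = f (x + \<tau> *\<^sub>R h + \<tau> *\<^sub>R k) - f (x + \<tau> *\<^sub>R h) - f (x + \<tau> *\<^sub>R k) + f x"
    have a: "\<bar>R - \<tau>\<^sup>2 * (H h \<bullet> k)\<bar> \<le> 2 * e * (\<tau> * N)\<^sup>2"
      using second_difference_bound[OF G lin d(2) _ e, where h="\<tau> *\<^sub>R h" and k="\<tau> *\<^sub>R k"] sm \<tau>N
      by (simp add: R_def linear_scale[OF lin] power2_eq_square mult.assoc)
    have b: "\<bar>R - \<tau>\<^sup>2 * (H k \<bullet> h)\<bar> \<le> 2 * e * (\<tau> * N)\<^sup>2"
    proof -
      have "R = f (x + \<tau> *\<^sub>R k + \<tau> *\<^sub>R h) - f (x + \<tau> *\<^sub>R k) - f (x + \<tau> *\<^sub>R h) + f x"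
        by (simp add: R_def add_ac)
      moreover have "norm (\<tau> *\<^sub>R k) + norm (\<tau> *\<^sub>R h) = \<tau> * N"
        using sm by simp
      ultimately show ?thesis
        using second_difference_bound[OF G lin d(2) _ e, where h="\<tau> *\<^sub>R k" and k="\<tau> *\<^sub>R h"] \<tau>N
        by (simp add: linear_scale[OF lin] power2_eq_square mult.assoc)
    qed
    have "\<tau>\<^sup>2 * \<bar>H h \<bullet> k - H k \<bullet> h\<bar> = \<bar>\<tau>\<^sup>2 * (H h \<bullet> k) - \<tau>\<^sup>2 * (H k \<bullet> h)\<bar>"
      by (simp add: abs_mult flip: right_diff_distrib)
    also have "\<dots> \<le> \<tau>\<^sup>2 * (4 * e * N\<^sup>2)"
    proof -
      have "2 * e * (\<tau> * N)\<^sup>2 + 2 * e * (\<tau> * N)\<^sup>2 = \<tau>\<^sup>2 * (4 * e * N\<^sup>2)"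
        by (simp add: power_mult_distrib)
      then show ?thesis using a b by linarith
    qed
    finally have "\<bar>H h \<bullet> k - H k \<bullet> h\<bar> \<le> 4 * e * N\<^sup>2"
      using \<tau> by simp
    also have "\<dots> \<le> \<epsilon>"
    proof -
      have "4 * e * N\<^sup>2 = \<epsilon> * (N\<^sup>2 / (N\<^sup>2 + 1))" unfolding e_def by algebra
      also have "\<dots> \<le> \<epsilon> * 1"
        using that by (intro mult_left_mono) (auto simp: divide_le_eq_1 add_nonneg_pos)
      finally show ?thesis by simp
    qed
    finally show ?thesis by simp
  qed
  then have "\<bar>H h \<bullet> k - H k \<bullet> h\<bar> \<le> 0" by (rule field_le_epsilon)
  then show ?thesis by simp
qed

section \<open>Convexity: tangents and the second derivative\<close>

lemma convex_on_gradient: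
  fixes f :: "'a::euclidean_space \<Rightarrow> real"
  assumes c: "convex_on UNIV f" and G: "GDERIV f x :> g"
  shows "f y - f x \<ge> g \<bullet> (y - x)"
proof -
  have D: "((\<lambda>t::real. f (x + t *\<^sub>R (y - x))) has_real_derivative g \<bullet> (y - x)) (at 0 within UNIV)"
    using G by (intro GDERIV_line) simp
  have "convex_on UNIV (\<lambda>t::real. f (x + t *\<^sub>R (y - x)))"
  proof (rule convex_onI)
    fix t a b :: real assume t: "0 < t" "t < 1"
    have "x + ((1 - t) *\<^sub>R a + t *\<^sub>R b) *\<^sub>R (y - x)
        = (1 - t) *\<^sub>R (x + a *\<^sub>R (y - x)) + t *\<^sub>R (x + b *\<^sub>R (y - x))"
      by (simp add: algebra_simps)
    then show "f (x + ((1 - t) *\<^sub>R a + t *\<^sub>R b) *\<^sub>R (y - x))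
        \<le> (1 - t) * f (x + a *\<^sub>R (y - x)) + t * f (x + b *\<^sub>R (y - x))"
      using convex_onD[OF c, of t] t by simp
  qed auto
  from convex_on_imp_above_tangent[OF this _ _ _ D, of 1] show ?thesis by simp
qed

text \<open>Adding the tangent inequalities at two points of a line shows that the directional
  derivative is nondecreasing along it; its own derivative at 0 is
  \<open>H v \<bullet> v\<close>.\<close>

lemma derivative_of_convex_gradient_nonneg:
  fixes f :: "'a::euclidean_space \<Rightarrow> real"
  assumes c: "convex_on UNIV f" and G: "\<And>y. GDERIV f y :> g y"
    and H: "(g has_derivative H) (at x)"
  shows "H v \<bullet> v \<ge> 0"
proof -
  have "((\<lambda>t::real. g (x + t *\<^sub>R v)) has_derivative (\<lambda>h. H (h *\<^sub>R v))) (at 0)"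
    using H by (intro has_derivative_line) simp
  then have "((\<lambda>t::real. g (x + t *\<^sub>R v) \<bullet> v) has_derivative (\<lambda>h. H (h *\<^sub>R v) \<bullet> v)) (at 0)"
    by (rule has_derivative_inner_left)
  then have "((\<lambda>t::real. g (x + t *\<^sub>R v) \<bullet> v) has_real_derivative H v \<bullet> v) (at 0)"
    by (simp add: has_field_derivative_def linear_scale[OF has_derivative_linear[OF H]] mult_commute_abs)
  moreover have "g (x + s *\<^sub>R v) \<bullet> v \<le> g (x + t *\<^sub>R v) \<bullet> v" if "s \<le> t" for s t :: real
  proof (cases "s = t")
    case False
    have "(t - s) * (g (x + s *\<^sub>R v) \<bullet> v) \<le> f (x + t *\<^sub>R v) - f (x + s *\<^sub>R v)"
      "(s - t) * (g (x + t *\<^sub>R v) \<bullet> v) \<le> f (x + s *\<^sub>R v) - f (x + t *\<^sub>R v)"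
      using convex_on_gradient[OF c G, of "x + s *\<^sub>R v" "x + t *\<^sub>R v"]
        convex_on_gradient[OF c G, of "x + t *\<^sub>R v" "x + s *\<^sub>R v"]
      by (simp_all add: inner_scaleR_right flip: scaleR_left_diff_distrib)
    then have "(t - s) * (g (x + s *\<^sub>R v) \<bullet> v) \<le> (t - s) * (g (x + t *\<^sub>R v) \<bullet> v)"
      by (simp add: algebra_simps)
    then show ?thesis using False that by simp
  qed simp
  ultimately show ?thesis
    by (intro mono_on_imp_deriv_nonneg[of UNIV "\<lambda>t. g (x + t *\<^sub>R v) \<bullet> v"]) (auto intro: mono_onI)
qed

section \<open>Optimality conditions on a ball\<close>

text \<open>The competitor of length \<open>\<Delta>\<close> in the direction of \<open>- r\<close>
  attains equality in Cauchy-Schwarz. With \<open>r = g + H s\<close>, the second claim shows that a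
  step off the boundary satisfies the Newton equation \<open>r = 0\<close>.\<close>

lemma closed_ball_linear_min:
  fixes r s :: "'a::real_inner"
  assumes s: "norm s \<le> \<Delta>" and min: "\<And>t. norm t \<le> \<Delta> \<Longrightarrow> r \<bullet> s \<le> r \<bullet> t"
  shows "r \<bullet> s = - norm r * \<Delta>" and "r \<noteq> 0 \<Longrightarrow> norm s = \<Delta>"
proof -
  have \<Delta>: "\<Delta> \<ge> 0" using s norm_ge_zero order_trans by blast
  have le: "r \<bullet> s \<le> - norm r * \<Delta>"
    using min[of "- (\<Delta> / norm r) *\<^sub>R r"] \<Delta>
    by (cases "r = 0") (auto simp: power2_norm_eq_inner[symmetric] power2_eq_square mult.commute)
  have ge: "- (norm r * norm s) \<le> r \<bullet> s"
    using Cauchy_Schwarz_ineq2[of r s] by linarith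
  moreover have "norm r * norm s \<le> norm r * \<Delta>"
    using s by (intro mult_left_mono) auto
  ultimately show "r \<bullet> s = - norm r * \<Delta>" using le by simp
  show "norm s = \<Delta>" if "r \<noteq> 0"
  proof -
    have "norm r * \<Delta> \<le> norm r * norm s" using le ge by simp
    then show ?thesis using that s by simp
  qed
qed

text \<open>Move from \<open>s\<close> towards \<open>t\<close> by a fraction \<open>a\<close>,
  divide the change by \<open>a\<close> and let \<open>a\<close> tend to 0; symmetry merges the
  mixed terms. The result makes \<open>closed_ball_linear_min\<close> applicable to
  \<open>g + H s\<close>.\<close>

lemma quadratic_ball_min:
  fixes s g :: "'a::real_inner"
  assumes lin: "linear H" and sym: "\<And>u v. H u \<bullet> v = H v \<bullet> u"
    and s: "norm s \<le> \<Delta>"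
    and min: "\<And>t. norm t \<le> \<Delta> \<Longrightarrow> g \<bullet> s + 1/2 * (H s \<bullet> s) \<le> g \<bullet> t + 1/2 * (H t \<bullet> t)"
    and t: "norm t \<le> \<Delta>"
  shows "(g + H s) \<bullet> s \<le> (g + H s) \<bullet> t"
proof -
  define v where "v = t - s"
  have quad: "0 \<le> (g + H s) \<bullet> v + a / 2 * (H v \<bullet> v)" if a: "0 < a" "a < 1" for a
  proof -
    have "s + a *\<^sub>R v = (1 - a) *\<^sub>R s + a *\<^sub>R t" by (simp add: v_def algebra_simps)
    moreover have "norm ((1 - a) *\<^sub>R s + a *\<^sub>R t) \<le> (1 - a) * \<Delta> + a * \<Delta>"
      using a s t by (intro order_trans[OF norm_triangle_ineq] add_mono) (auto simp: mult_left_mono)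
    moreover have "(1 - a) * \<Delta> + a * \<Delta> = \<Delta>" by (simp add: algebra_simps)
    ultimately have "norm (s + a *\<^sub>R v) \<le> \<Delta>" by simp
    from min[OF this]
    have "0 \<le> a * ((g + H s) \<bullet> v + a / 2 * (H v \<bullet> v))"
      using sym[of s v]
      by (simp add: linear_add[OF lin] linear_scale[OF lin] inner_simps algebra_simps)
    then show ?thesis using a by (simp add: zero_le_mult_iff)
  qed
  have "((\<lambda>a. (g + H s) \<bullet> v + a / 2 * (H v \<bullet> v)) \<longlongrightarrow> (g + H s) \<bullet> v + 0 / 2 * (H v \<bullet> v)) (at_right 0)"
    by (intro tendsto_intros) auto
  moreover have "eventually (\<lambda>a. 0 \<le> (g + H s) \<bullet> v + a / 2 * (H v \<bullet> v)) (at_right 0)"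
    using quad by (auto simp: eventually_at_right[of 0 1] intro!: exI[of _ 1])
  ultimately have "0 \<le> (g + H s) \<bullet> v"
    by (auto dest: tendsto_lowerbound)
  then show ?thesis by (simp add: v_def inner_diff_right)
qed

section \<open>Taylor estimates for a Hoelder continuous Hessian\<close>

text \<open>The variation of the Hessian is bounded by its maximum over the ball of radius
  \<open>norm s\<close>. Integration would give a smaller constant, but only the exponent affects
  the rate.\<close>

lemma holder_gradient_linearization:
  fixes g :: "'a::euclidean_space \<Rightarrow> 'a" and H :: "'a \<Rightarrow> 'a \<Rightarrow>\<^sub>L 'a"
  assumes D: "\<And>y. (g has_derivative blinfun_apply (H y)) (at y)"
    and hol: "\<And>y z. norm (H y - H z) \<le> L * norm (y - z) powr \<nu>"
    and L: "L \<ge> 0" and \<nu>: "\<nu> \<ge> 0"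
  shows "norm (g (x + s) - g x - H x s) \<le> L * norm s powr (1 + \<nu>)"
proof -
  have "norm (g (x + s) - g x - H x ((x + s) - x)) \<le> norm ((x + s) - x) * (L * norm s powr \<nu>)"
  proof (rule differentiable_bound_linearization[where S = "cball x (norm s)"
        and f' = "\<lambda>y. blinfun_apply (H y)"])
    fix t :: real assume "t \<in> {0..1}"
    then show "x + t *\<^sub>R (x + s - x) \<in> cball x (norm s)"
      by (simp add: dist_norm mult_left_le_one_le)
  next
    fix y assume "y \<in> cball x (norm s)"
    then have "norm (y - x) powr \<nu> \<le> norm s powr \<nu>"
      using \<nu> by (intro powr_mono2) (auto simp: dist_norm norm_minus_commute)
    then have "norm (H y - H x) \<le> L * norm s powr \<nu>"
      using hol[of y x] L by (meson mult_left_mono order_trans)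
    then show "onorm (blinfun_apply (H y) - blinfun_apply (H x)) \<le> L * norm s powr \<nu>"
      by (simp add: norm_blinfun.rep_eq minus_blinfun.rep_eq fun_diff_def)
  qed (auto intro: has_derivative_at_withinI D)
  then show ?thesis by (simp add: powr_add mult.left_commute)
qed

text \<open>Subtracting the non-constant part of the model from \<open>f\<close> on the segment
  reduces the error to a gradient linearization error at an intermediate point.\<close>

lemma holder_taylor2:
  fixes g :: "'a::euclidean_space \<Rightarrow> 'a" and H :: "'a \<Rightarrow> 'a \<Rightarrow>\<^sub>L 'a"
  assumes G: "\<And>y. GDERIV f y :> g y"
    and D: "\<And>y. (g has_derivative blinfun_apply (H y)) (at y)"
    and hol: "\<And>y z. norm (H y - H z) \<le> L * norm (y - z) powr \<nu>"
    and L: "L \<ge> 0" and \<nu>: "\<nu> \<ge> 0"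
  shows "\<bar>f (x + s) - (f x + g x \<bullet> s + 1/2 * (H x s \<bullet> s))\<bar> \<le> L * norm s powr (2 + \<nu>)"
proof -
  define \<phi> where "\<phi> t = f (x + t *\<^sub>R s) - (t * (g x \<bullet> s) + t\<^sup>2 / 2 * (H x s \<bullet> s))" for t
  have "(\<phi> has_real_derivative (g (x + t *\<^sub>R s) \<bullet> s - (g x \<bullet> s + t * (H x s \<bullet> s)))) (at t)" for t
    unfolding \<phi>_def by (intro DERIV_diff GDERIV_line G) (auto intro!: derivative_eq_intros)
  from MVT2[of 0 1 \<phi>, OF _ this] obtain t where t: "0 < t" "t < 1"
    and eq: "\<phi> 1 - \<phi> 0 = g (x + t *\<^sub>R s) \<bullet> s - (g x \<bullet> s + t * (H x s \<bullet> s))" by auto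
  have "f (x + s) - (f x + g x \<bullet> s + 1/2 * (H x s \<bullet> s)) = \<phi> 1 - \<phi> 0"
    by (simp add: \<phi>_def)
  also have "\<dots> = (g (x + t *\<^sub>R s) - g x - H x (t *\<^sub>R s)) \<bullet> s"
    by (simp add: eq inner_simps blinfun.scaleR_right)
  also have "\<bar>\<dots>\<bar> \<le> L * norm s powr (1 + \<nu>) * norm s"
  proof (rule order_trans[OF Cauchy_Schwarz_ineq2], rule mult_right_mono)
    have "norm (g (x + t *\<^sub>R s) - g x - H x (t *\<^sub>R s)) \<le> L * norm (t *\<^sub>R s) powr (1 + \<nu>)"
      by (rule holder_gradient_linearization[OF D hol L \<nu>])
    also have "\<dots> \<le> L * norm s powr (1 + \<nu>)"
      using t L \<nu> by (intro mult_left_mono powr_mono2) (auto simp: mult_left_le_one_le)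
    finally show "norm (g (x + t *\<^sub>R s) - g x - H x (t *\<^sub>R s)) \<le> L * norm s powr (1 + \<nu>)" .
  qed simp
  also have "\<dots> = L * norm s powr (2 + \<nu>)"
    by (simp add: powr_add powr_numeral power2_eq_square)
  finally show ?thesis .
qed

section \<open>Gradient norm against objective gap\<close>

text \<open>The bound \<open>D\<close> says nothing directly about a \<open>y\<close> outside the
  level set of \<open>x0\<close>. Such a \<open>y\<close> is pulled towards its nearest minimizer
  until convexity puts it into the level set; the minimum on the left accounts for this.\<close>

lemma gradient_norm_lower:
  fixes f :: "'a::euclidean_space \<Rightarrow> real"
  assumes c: "convex_on UNIV f" and G: "\<And>y. GDERIV f y :> g y"
    and ne: "minimizers f \<noteq> {}"
    and D: "\<And>z. f z \<le> f x0 \<Longrightarrow> infdist z (minimizers f) \<le> D"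
  shows "min (f y - min_value f) (f x0 - min_value f) \<le> D * norm (g y)"
proof -
  have cont: "continuous_on UNIV f"
    using G by (meson continuous_at_imp_continuous_on gderiv_def has_derivative_continuous)
  have "minimizers f = (\<Inter>y. {x. f x \<le> f y})" by (auto simp: minimizers_def)
  then have "closed (minimizers f)"
    using cont by (auto intro!: closed_INT closed_Collect_le)
  then obtain p where p: "p \<in> minimizers f" and dist: "infdist y (minimizers f) = dist y p"
    using ne infdist_attains_inf by blast
  have fp: "min_value f = f p"
    using p by (auto simp: min_value_def minimizers_def intro!: cInf_eq_minimum)
  define m where "m = min (f y - f p) (f x0 - f p)"
  have m: "m \<ge> 0" using p by (simp add: m_def minimizers_def)
  have D0: "D \<ge> 0" using D[of x0] infdist_nonneg order_trans by blast
  show ?thesis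
  proof (cases "m = 0")
    case True
    then show ?thesis using D0 by (simp add: fp m_def)
  next
    case False
    with m have m0: "m > 0" by simp
    \<comment> \<open>With this \<open>t\<close> the chord from \<open>p\<close> to \<open>y\<close>
      has the value \<open>f p + m\<close> at \<open>z\<close>, so \<open>z\<close> lies in the
      level set; if \<open>y\<close> already does, then \<open>t = 1\<close>.\<close>
    define t where "t = m / (f y - f p)"
    have gap: "f y - f p \<ge> m" by (simp add: m_def)
    have t: "0 < t" "t \<le> 1" and tm: "t * (f y - f p) = m"
      using m0 gap by (auto simp: t_def)
    define z where "z = (1 - t) *\<^sub>R p + t *\<^sub>R y"
    have "f z \<le> (1 - t) * f p + t * f y"
      unfolding z_def using t by (intro convex_onD[OF c]) auto
    also have "\<dots> = f p + m" using tm by (simp add: algebra_simps)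
    also have "\<dots> \<le> f x0" by (simp add: m_def)
    finally have zD: "infdist z (minimizers f) \<le> D" by (rule D)
    have "y - z = (1 - t) *\<^sub>R (y - p)" by (simp add: z_def algebra_simps)
    then have "dist y z = (1 - t) * dist y p" using t by (simp add: dist_norm)
    \<comment> \<open>As \<open>p\<close> is a nearest minimizer to \<open>y\<close>, the triangle
      inequality through \<open>z\<close> reads
      \<open>dist y p \<le> D + (1 - t) * dist y p\<close>.\<close>
    then have tD: "t * dist y p \<le> D"
      using infdist_triangle[of y "minimizers f" z] zD dist by (simp add: algebra_simps)
    have "f y - f p \<le> norm (g y) * dist y p"
      using convex_on_gradient[OF c G, of y p] Cauchy_Schwarz_ineq2[of "g y" "p - y"]
      by (simp add: dist_norm norm_minus_commute)
    then have "m \<le> norm (g y) * (t * dist y p)"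
      using t mult_left_mono[of "f y - f p" "norm (g y) * dist y p" t]
      by (simp add: tm mult.left_commute)
    also have "\<dots> \<le> norm (g y) * D" using tD by (intro mult_left_mono) auto
    finally show ?thesis by (simp add: m_def fp mult.commute)
  qed
qed

section \<open>Counting the steps of a run\<close>

text \<open>For solutions of \<open>u' = - c * u powr (1 + p)\<close> the quantity
  \<open>u powr (- p)\<close> grows at rate \<open>p * c\<close>. The discrete version rests on the
  Bernoulli inequality \<open>1 + p * y \<le> (1 - y) powr (- p)\<close>.\<close>

lemma powr_neg_increment:
  fixes d d' p c :: real
  assumes "d > 0" "d' > 0" "p > 0" and le: "d' \<le> d - c * d powr (1 + p)"
  shows "d powr (- p) + p * c \<le> d' powr (- p)"
proof -
  define y where "y = c * d powr p"
  have d': "d' \<le> d * (1 - y)" using le \<open>d > 0\<close> by (simp add: y_def powr_add algebra_simps)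
  with assms(2) have "0 < d * (1 - y)" by linarith
  then have y: "y < 1" using assms(1) by (simp add: zero_less_mult_iff)
  have "1 + p * y \<le> exp (- p * ln (1 - y))"
  proof -
    have "ln (1 - y) \<le> - y" using ln_le_minus_one[of "1 - y"] y by simp
    then have "p * y \<le> - p * ln (1 - y)"
      using \<open>p > 0\<close> mult_left_mono[of y "- ln (1 - y)" p] by simp
    then show ?thesis using exp_ge_add_one_self[of "- p * ln (1 - y)"] by linarith
  qed
  also have "\<dots> = (1 - y) powr (- p)" using y by (simp add: powr_def)
  finally have "d powr (- p) * (1 + p * y) \<le> d powr (- p) * (1 - y) powr (- p)"
    by (intro mult_left_mono) auto
  also have "\<dots> = (d * (1 - y)) powr (- p)" using assms y by (simp add: powr_mult)
  also have "\<dots> \<le> d' powr (- p)"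
    using d' assms by (intro powr_mono2') auto
  finally show ?thesis
    using assms(1) by (simp add: y_def distrib_left powr_minus field_simps)
qed

text \<open>
  The potential \<open>a * d k powr (- p) - b * ln (\<Delta> k)\<close> increases by at least 1 in every step: the first
  summand pays for the steps that decrease \<open>d\<close>, the second one for those that only shrink \<open>\<Delta>\<close>.
\<close>

lemma iteration_count:
  fixes d \<Delta> :: "nat \<Rightarrow> real"
  assumes d: "\<And>k. d k > 0" and pos: "p > 0" "c > 0" "c1 > 0"
    and \<gamma>2: "0 < \<gamma>2" "\<gamma>2 < 1" and \<gamma>3: "\<gamma>3 \<ge> 1"
    and lower: "\<And>k. c * d k powr p \<le> \<Delta> k"
    and step: "\<And>k. d (Suc k) \<le> d k - c1 * d k powr (1 + p) \<and> \<Delta> (Suc k) \<le> \<gamma>3 * \<Delta> k \<or>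
      d (Suc k) = d k \<and> \<Delta> (Suc k) \<le> \<gamma>2 * \<Delta> k"
    and b: "b = 1 / ln (1 / \<gamma>2)" and a: "a = (1 + b * ln \<gamma>3) / (p * c1)"
  shows "real k \<le> (a + b) * d k powr (- p) + b * (ln (\<Delta> 0) - ln c)"
proof -
  have b0: "b > 0" using \<gamma>2 by (simp add: b)
  have a0: "a > 0" using b0 \<gamma>3 pos by (simp add: a add_pos_nonneg)
  have \<Delta>: "\<Delta> k > 0" for k
    using lower[of k] d[of k] pos by (smt (verit) mult_pos_pos powr_gt_zero)
  define V where "V k = a * d k powr (- p) - b * ln (\<Delta> k)" for k
  have V_step: "V k + 1 \<le> V (Suc k)" for k
    using step[of k]
  proof (elim disjE conjE)
    assume dec: "d (Suc k) \<le> d k - c1 * d k powr (1 + p)" and up: "\<Delta> (Suc k) \<le> \<gamma>3 * \<Delta> k"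
    have "a * (d k powr (- p) + p * c1) \<le> a * d (Suc k) powr (- p)"
      using a0 powr_neg_increment[OF d d \<open>p > 0\<close> dec] by simp
    \<comment> \<open>The gain in the first summand thus covers the required 1 and the loss
      \<open>b * ln \<gamma>3\<close> from an enlarged radius.\<close>
    moreover have "a * (p * c1) = 1 + b * ln \<gamma>3" using pos by (simp add: a)
    moreover have "ln (\<Delta> (Suc k)) \<le> ln \<gamma>3 + ln (\<Delta> k)"
      using up \<Delta>[of k] \<Delta>[of "Suc k"] \<gamma>3 by (simp flip: ln_mult_pos)
    then have "b * ln (\<Delta> (Suc k)) \<le> b * (ln \<gamma>3 + ln (\<Delta> k))"
      using b0 by simp
    ultimately show ?thesis by (simp add: V_def distrib_left)
  next
    assume eq: "d (Suc k) = d k" and shrink: "\<Delta> (Suc k) \<le> \<gamma>2 * \<Delta> k"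
    have "ln (\<Delta> (Suc k)) \<le> ln \<gamma>2 + ln (\<Delta> k)"
      using shrink \<Delta>[of k] \<Delta>[of "Suc k"] \<gamma>2 by (simp flip: ln_mult_pos)
    then have "b * ln (\<Delta> (Suc k)) \<le> b * (ln \<gamma>2 + ln (\<Delta> k))"
      using b0 by simp
    moreover have "b * ln \<gamma>2 = - 1" using \<gamma>2 by (simp add: b ln_div)
    ultimately show ?thesis by (simp add: V_def eq distrib_left)
  qed
  have V: "V 0 + real k \<le> V k"
  proof (induction k)
    case (Suc k)
    then show ?case using V_step[of k] by simp
  qed simp
  \<comment> \<open>The lower bound on the radius limits the second summand of the potential to
    order \<open>d k powr (- p)\<close>, whence the coefficient \<open>a + b\<close>.\<close>
  have "ln c + p * ln (d k) \<le> ln (\<Delta> k)"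
  proof -
    have "ln (c * d k powr p) \<le> ln (\<Delta> k)" using lower[of k] d[of k] pos \<Delta>[of k] by simp
    then show ?thesis using pos d[of k] by (simp add: ln_mult_pos ln_powr)
  qed
  moreover have "- (p * ln (d k)) \<le> d k powr (- p)"
    using ln_bound[of "d k powr (- p)"] d[of k] by (simp add: ln_powr)
  ultimately have "- ln (\<Delta> k) \<le> d k powr (- p) - ln c" by linarith
  then have "b * - ln (\<Delta> k) \<le> b * (d k powr (- p) - ln c)" using b0 by (intro mult_left_mono) auto
  moreover have "a * d 0 powr (- p) \<ge> 0" using a0 by simp
  ultimately show ?thesis using V by (simp add: V_def algebra_simps)
qed

section \<open>Real arithmetic for roots and the acceptance ratio\<close>

lemma powr_inverse_le:
  fixes a u n q :: real
  assumes "a \<ge> 0" "u \<ge> 0" "n \<ge> 0" "q > 0" and le: "a * u \<le> n powr q"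
  shows "a powr (1 / q) * u powr (1 / q) \<le> n"
proof -
  have "(a * u) powr (1 / q) \<le> (n powr q) powr (1 / q)"
    using assms by (intro powr_mono2) auto
  then show ?thesis using assms by (simp add: powr_powr powr_mult)
qed

text \<open>Here \<open>P\<close> is the model decrease, \<open>A\<close> the actual decrease,
  \<open>\<mu>\<close> the smaller gradient norm, \<open>n\<close> the step length and
  \<open>e * n\<close> the model error. The slack \<open>2 * \<delta>\<close> in the condition on
  \<open>\<eta>\<close> is spent once on the loss in \<open>P\<close> against
  \<open>\<mu> * n\<close> and once on the loss of \<open>A\<close> against
  \<open>P\<close>.\<close>

lemma ratio_large:
  fixes P A \<mu> n e \<theta> \<eta> \<delta> :: real
  assumes "\<mu> * n \<le> P + e * n" "P - A \<le> e * n" "e \<le> \<delta> * \<mu>" "\<mu> \<ge> 0" "n \<ge> 0"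
    and \<delta>: "2 * \<delta> = 1 - \<eta> * (1 + \<theta> / 2)" "\<delta> \<ge> 0" and \<eta>: "0 < \<eta>" "\<eta> < 1"
  shows "\<eta> * (P + \<theta> / 2 * \<mu> * n) \<le> A"
proof -
  have en: "e * n \<le> \<delta> * (\<mu> * n)" using assms by (simp add: mult_right_mono flip: mult.assoc)
  then have "(1 - \<eta>) * ((1 - \<delta>) * (\<mu> * n)) \<le> (1 - \<eta>) * P"
    using assms by (intro mult_left_mono) (auto simp: algebra_simps)
  moreover have "(1 - \<eta>) * ((1 - \<delta>) * (\<mu> * n))
      = \<delta> * (\<mu> * n) + \<eta> * (\<theta> / 2 * \<mu> * n) + \<eta> * \<delta> * (\<mu> * n)
        + (1 - 2 * \<delta> - \<eta> * (1 + \<theta> / 2)) * (\<mu> * n)"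
    by (simp add: algebra_simps)
  moreover have "\<eta> * \<delta> * (\<mu> * n) \<ge> 0" using assms by simp
  ultimately have "\<delta> * (\<mu> * n) + \<eta> * (\<theta> / 2 * \<mu> * n) \<le> (1 - \<eta>) * P"
    using \<delta>(1) by simp
  then show ?thesis using en assms(2) by (simp add: algebra_simps)
qed

text \<open>By \<open>ratio_large\<close>, a small ratio forces \<open>\<delta> * \<mu> < e\<close>,
  so the regularization term is at most \<open>\<theta> / (2 * \<delta>)\<close> times the model
  error. Since \<open>\<eta> < 1\<close>, the small ratio then bounds \<open>P\<close>, and with it
  \<open>A\<close>, by a multiple of that error.\<close>

lemma ratio_small_decrease:
  fixes P A \<mu> n e \<theta> \<eta> \<delta> :: real
  assumes small: "A / (P + \<theta> / 2 * \<mu> * n) < \<eta>"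
    and hyps: "\<mu> * n \<le> P + e * n" "\<bar>A - P\<bar> \<le> e * n" "\<mu> \<ge> 0" "n \<ge> 0" "P \<ge> 0" "\<theta> > 0"
    and \<delta>: "2 * \<delta> = 1 - \<eta> * (1 + \<theta> / 2)" "\<delta> > 0" and \<eta>: "0 < \<eta>" "\<eta> < 1"
    and K: "K = (1 + \<theta> / (2 * \<delta>)) / (1 - \<eta>) + \<theta> / (2 * \<delta>)"
  shows "A \<le> K * (e * n)" and "\<mu> > 0 \<Longrightarrow> n > 0 \<Longrightarrow> \<delta> * \<mu> < e"
proof -
  have en: "e * n \<ge> 0" using hyps(2) by linarith
  define R where "R = \<theta> / 2 * \<mu> * n"
  have R: "R \<ge> 0" using hyps by (simp add: R_def)
  define q where "q = \<theta> / (2 * \<delta>)"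
  have q: "q \<ge> 0" using hyps \<delta>(2) by (simp add: q_def)
  have K: "K = (1 + q) / (1 - \<eta>) + q" using K by (simp only: q_def)
  have K1: "1 \<le> K"
  proof -
    have "1 - \<eta> \<le> 1 + q" using q \<eta> by simp
    then have "1 \<le> (1 + q) / (1 - \<eta>)"
      using \<eta> by (simp add: pos_le_divide_eq)
    then show ?thesis using q unfolding K by linarith
  qed
  have big: "\<delta> * \<mu> < e \<and> A < \<eta> * (P + R)" if "P + R > 0"
  proof -
    have "A < \<eta> * (P + R)" using small that by (simp add: R_def pos_divide_less_eq)
    then show ?thesis
      using ratio_large[of \<mu> n P e A \<delta> \<eta> \<theta>] hyps \<delta> \<eta> by (force simp: R_def)
  qed
  show "A \<le> K * (e * n)"
  proof (cases "P + R > 0")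
    \<comment> \<open>The denominator vanishes here and the quotient is 0 by convention, so the
      ratio carries no information; the model error alone bounds \<open>A\<close>.\<close>
    case False
    then have "A \<le> e * n" using R hyps by linarith
    then show ?thesis using K1 en mult_right_mono[of 1 K "e * n"] by simp
  next
    case True
    have "\<delta> * (\<mu> * n) \<le> e * n" using big[OF True] hyps
      by (simp add: mult_right_mono flip: mult.assoc)
    moreover have "R = q * (\<delta> * (\<mu> * n))"
      using \<delta>(2) by (simp add: R_def q_def)
    ultimately have Rle: "R \<le> q * (e * n)"
      using q by (simp add: mult_left_mono)
    have "\<eta> * R \<le> R" using R \<eta> by (simp add: mult_left_le_one_le)
    moreover have "A < \<eta> * P + \<eta> * R" using big[OF True] by (simp add: distrib_left)
    ultimately have "(1 - \<eta>) * P \<le> e * n + q * (e * n)"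
      using hyps(2) Rle by (simp add: algebra_simps)
    then have "P \<le> (1 + q) / (1 - \<eta>) * (e * n)"
      using \<eta> by (simp add: pos_le_divide_eq algebra_simps)
    moreover have "A \<le> P + R"
      using big[OF True] True \<eta> mult_left_le_one_le[of "P + R" \<eta>] by linarith
    ultimately show ?thesis using Rle by (simp add: K distrib_right)
  qed
  show "\<delta> * \<mu> < e" if "\<mu> > 0" "n > 0"
    using big that hyps by (simp add: R_def add_nonneg_pos)
qed

section \<open>The convex problem and a single trust-region step\<close>

locale holder_convex =
  fixes f :: "'a::euclidean_space \<Rightarrow> real" and L \<nu> D :: real and x0 :: 'a
  assumes convex: "convex_on UNIV f"
    and smooth: "twice_cont_diff f"
    and minimizers: "minimizers f \<noteq> {}"
    and L: "L > 0" and \<nu>: "\<nu> \<ge> 0" and D: "D > 0"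
    and holder: "norm (hessian f x - hessian f y) \<le> L * norm (x - y) powr \<nu>"
    and level: "f z \<le> f x0 \<Longrightarrow> infdist z (minimizers f) \<le> D"
begin

definition gap :: "'a \<Rightarrow> real" where
  "gap x = f x - min_value f"

lemma gradient: "GDERIV f x :> gradient f x"
  using smooth by (auto simp: twice_cont_diff_def intro: GDERIV_gradient)

lemma hessian: "(gradient f has_derivative blinfun_apply (hessian f x)) (at x)"
  using smooth by (auto simp: twice_cont_diff_def intro: has_derivative_hessian)

lemma hessian_nonneg: "hessian f x v \<bullet> v \<ge> 0"
  by (rule derivative_of_convex_gradient_nonneg[OF convex gradient hessian])

lemma linear_hessian: "linear (blinfun_apply (hessian f x))"
  by (rule has_derivative_linear[OF hessian])

lemma gap_nonneg: "gap x \<ge> 0"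
proof -
  obtain p where "p \<in> minimizers f" using minimizers by blast
  then have "bdd_below (range f)" by (auto simp: minimizers_def bdd_below_def)
  then show ?thesis by (simp add: gap_def min_value_def cINF_lower)
qed

lemma gap_le_gradient: "min (gap y) (gap x0) \<le> D * norm (gradient f y)"
  unfolding gap_def by (rule gradient_norm_lower[OF convex gradient minimizers level])

context
  fixes x s :: 'a and \<Delta> :: real
  assumes opt: "is_arg_min (model f x) (\<lambda>t. norm t \<le> \<Delta>) s" and \<Delta>: "\<Delta> > 0"
begin

lemma residual_variation:
  assumes "norm t \<le> \<Delta>"
  shows "(gradient f x + hessian f x s) \<bullet> s \<le> (gradient f x + hessian f x s) \<bullet> t"
proof (rule quadratic_ball_min[OF linear_hessian _ _ _ assms])
  show "hessian f x u \<bullet> v = hessian f x v \<bullet> u" for u v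
    by (rule symmetric_second_derivative[OF gradient hessian])
qed (use opt in \<open>auto simp: is_arg_min_linorder model_def add.assoc\<close>)

lemma step_in_ball: "norm s \<le> \<Delta>"
  using opt by (simp add: is_arg_min_def)

lemmas residual = closed_ball_linear_min[OF step_in_ball residual_variation]

text \<open>By convexity the model decrease is at least minus the inner product of the residual with
  \<open>s\<close>, which by optimality on the ball equals the residual norm times
  \<open>\<Delta>\<close>.\<close>

lemma model_decrease:
  "norm (gradient f x + hessian f x s) * norm s \<le> model f x 0 - model f x s"
proof -
  let ?r = "gradient f x + hessian f x s"
  have "norm ?r * norm s \<le> norm ?r * \<Delta>"
    using step_in_ball by (intro mult_left_mono) auto
  also have "\<dots> = - (?r \<bullet> s)" using residual(1) by simp
  also have "\<dots> \<le> model f x 0 - model f x s"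
    using hessian_nonneg[of x s] by (simp add: model_def inner_add_left)
  finally show ?thesis .
qed

lemma model_decrease_nonneg: "0 \<le> model f x 0 - model f x s"
  using model_decrease by (meson mult_nonneg_nonneg norm_ge_zero order_trans)

lemma gradient_linearization:
  "norm (gradient f (x + s)) \<le> norm (gradient f x + hessian f x s) + L * norm s powr (1 + \<nu>)"
proof -
  have "norm (gradient f (x + s) - gradient f x - hessian f x s) \<le> L * norm s powr (1 + \<nu>)"
    using L \<nu> by (intro holder_gradient_linearization hessian holder) auto
  then show ?thesis
    using norm_triangle_sub[of "gradient f (x + s)" "gradient f x + hessian f x s"]
    by (simp add: algebra_simps)
qed

text \<open>Supplies the hypothesis \<open>\<mu> * n \<le> P + e * n\<close> of the ratio lemmas, as
  \<open>\<mu>\<close> is at most the gradient norm at the trial point.\<close>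

lemma new_gradient_le_model_decrease:
  "norm (gradient f (x + s)) * norm s
    \<le> model f x 0 - model f x s + L * norm s powr (1 + \<nu>) * norm s"
  using mult_right_mono[OF gradient_linearization, of "norm s"] model_decrease
  by (simp add: distrib_right)

lemma interior_step:
  assumes "norm s \<noteq> \<Delta>"
  shows "norm (gradient f (x + s)) \<le> L * norm s powr (1 + \<nu>)"
  using gradient_linearization residual(2) assms by fastforce

lemma model_error:
  "\<bar>f x - f (x + s) - (model f x 0 - model f x s)\<bar> \<le> L * norm s powr (1 + \<nu>) * norm s"
proof -
  have "\<bar>f (x + s) - model f x s\<bar> \<le> L * norm s powr (2 + \<nu>)"
    unfolding model_def using L \<nu> by (intro holder_taylor2 gradient hessian holder) auto
  moreover have "norm s powr (2 + \<nu>) = norm s powr (1 + \<nu>) * norm s"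
    by (simp add: powr_add powr_numeral power2_eq_square)
  moreover have "model f x 0 = f x" by (simp add: model_def)
  ultimately show ?thesis by (simp add: mult.assoc)
qed

lemma step_nonzero:
  assumes "gradient f x \<noteq> 0"
  shows "s \<noteq> 0"
  using residual(2) assms \<Delta> by (auto simp: blinfun.zero_right)

section \<open>Step length and decrease in terms of the gap\<close>

context
  assumes gap: "gap x > 0" and lev: "f x \<le> f x0"
begin

lemma gap_le: "gap x \<le> gap x0"
  using lev by (simp add: gap_def)

lemma gradient_nonzero: "gradient f x \<noteq> 0"
  using gap_le_gradient[of x] gap gap_le by auto

text \<open>\<open>gap_le_gradient\<close> caps the gap at \<open>gap x0\<close>, but the cap itself
  is at least \<open>gap x / 2\<close>, so the trial point may even leave the level set.\<close>

lemma small_decrease_gradient: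
  assumes "gap x / 2 \<le> gap (x + s)"
  shows "gap x / (2 * D) \<le> min (norm (gradient f x)) (norm (gradient f (x + s)))"
proof -
  have "gap x / 2 \<le> D * norm (gradient f x)"
    using gap_le_gradient[of x] gap gap_le by simp
  moreover have "gap x / 2 \<le> D * norm (gradient f (x + s))"
    using gap_le_gradient[of "x + s"] gap gap_le assms by simp
  ultimately show ?thesis using D by (simp add: field_simps)
qed

lemma small_ratio_step_norm:
  assumes \<theta>: "\<theta> > 0" and \<eta>: "0 < \<eta>" "\<eta> < 1"
    and \<delta>: "2 * \<delta> = 1 - \<eta> * (1 + \<theta> / 2)" "\<delta> > 0"
    and K: "K = (1 + \<theta> / (2 * \<delta>)) / (1 - \<eta>) + \<theta> / (2 * \<delta>)"
    and small: "unicat_ratio \<theta> f x s < \<eta>"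
  shows "min ((\<delta> / (2 * D * L)) powr (1 / (1 + \<nu>)))
      ((gap x0 powr (- (1 / (1 + \<nu>))) / (2 * K * L)) powr (1 / (2 + \<nu>)))
    * gap x powr (1 / (1 + \<nu>)) \<le> norm s"
proof -
  let ?p = "1 / (1 + \<nu>)" and ?\<mu> = "min (norm (gradient f x)) (norm (gradient f (x + s)))"
  let ?e = "L * norm s powr (1 + \<nu>)"
  have "?\<mu> * norm s \<le> norm (gradient f (x + s)) * norm s"
    by (intro mult_right_mono) auto
  then have \<mu>: "?\<mu> * norm s \<le> model f x 0 - model f x s + ?e * norm s"
    using new_gradient_le_model_decrease by linarith
  note dec = ratio_small_decrease[OF small[unfolded unicat_ratio_def] \<mu> model_error _ _
      model_decrease_nonneg \<theta> \<delta> \<eta> K]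
  have "(\<delta> / (2 * D * L)) powr ?p * gap x powr ?p \<le> norm s
    \<or> (gap x0 powr (- ?p) / (2 * K * L)) powr (1 / (2 + \<nu>)) * gap x powr ?p \<le> norm s"
  proof (cases "gap x / 2 \<le> gap (x + s)")
    case True
    note grad = small_decrease_gradient[OF True]
    have "gap x / (2 * D) > 0" using gap D by simp
    then have "?\<mu> > 0" using grad by linarith
    moreover have "norm s > 0" using step_nonzero[OF gradient_nonzero] by simp
    ultimately have "\<delta> * ?\<mu> < ?e" by (intro dec) auto
    moreover have "\<delta> * (gap x / (2 * D)) \<le> \<delta> * ?\<mu>"
      using grad \<delta> by (intro mult_left_mono) auto
    ultimately have "\<delta> * (gap x / (2 * D)) \<le> ?e" by linarith
    then have "\<delta> / (2 * D * L) * gap x \<le> norm s powr (1 + \<nu>)"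
      using D L by (simp add: field_simps)
    then show ?thesis
      using \<delta> D L gap \<nu> by (intro disjI1 powr_inverse_le) auto
  next
    case False
    have K0: "K > 0"
      unfolding K using \<theta> \<delta>(2) \<eta> by (intro add_pos_pos divide_pos_pos) auto
    \<comment> \<open>A large decrease with a small ratio must itself be of the order of the model
      error.\<close>
    have "gap x / 2 \<le> f x - f (x + s)" using False by (simp add: gap_def field_simps)
    also have "\<dots> \<le> K * (?e * norm s)" by (intro dec) auto
    also have "\<dots> = K * L * norm s powr (2 + \<nu>)"
      by (simp add: powr_add powr_numeral power2_eq_square)
    finally have "gap x \<le> 2 * K * L * norm s powr (2 + \<nu>)" by simp
    \<comment> \<open>Weakening \<open>gap x\<close> to a multiple of its power
      \<open>1 + ?p\<close> makes the root of order \<open>2 + \<nu>\<close> produce exactly the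
      exponent \<open>?p\<close>.\<close>
    moreover have "gap x0 powr (- ?p) * gap x powr (1 + ?p) \<le> gap x"
    proof -
      have "gap x powr ?p \<le> gap x0 powr ?p" using gap gap_le \<nu> by (intro powr_mono2) auto
      then show ?thesis using gap gap_le by (simp add: powr_add powr_minus field_simps)
    qed
    ultimately have "gap x0 powr (- ?p) * gap x powr (1 + ?p) \<le> 2 * K * L * norm s powr (2 + \<nu>)"
      by linarith
    then have "gap x0 powr (- ?p) / (2 * K * L) * gap x powr (1 + ?p) \<le> norm s powr (2 + \<nu>)"
      using K0 L by (simp add: field_simps)
    then have "(gap x0 powr (- ?p) / (2 * K * L)) powr (1 / (2 + \<nu>))
        * (gap x powr (1 + ?p)) powr (1 / (2 + \<nu>)) \<le> norm s"
      using K0 L \<nu> by (intro powr_inverse_le) auto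
    moreover have "(1 + ?p) * (1 / (2 + \<nu>)) = ?p" using \<nu> by (simp add: divide_simps)
    ultimately show ?thesis by (simp only: powr_powr) simp
  qed
  then show ?thesis
    by (elim disjE; elim order_trans[rotated]; intro mult_right_mono) auto
qed

text \<open>The regularization term in the denominator alone guarantees a decrease proportional to
  the smaller gradient norm times the step length. It remains to bound both factors below unless the
  step more than halves the gap.\<close>

lemma successful_decrease:
  assumes \<theta>: "\<theta> > 0" and \<eta>: "0 < \<eta>" and large: "unicat_ratio \<theta> f x s \<ge> \<eta>"
    and c: "c * gap x powr (1 / (1 + \<nu>)) \<le> \<Delta>" "c > 0"
  shows "gap (x + s) \<le> gap x - min (gap x0 powr (- (1 / (1 + \<nu>))) / 2)
      (\<eta> * \<theta> / (4 * D) * min c ((1 / (2 * D * L)) powr (1 / (1 + \<nu>))))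
    * gap x powr (1 + 1 / (1 + \<nu>))"
proof -
  let ?p = "1 / (1 + \<nu>)" and ?\<mu> = "min (norm (gradient f x)) (norm (gradient f (x + s)))"
  define c' where "c' = min c ((1 / (2 * D * L)) powr ?p)"
  define R where "R = \<theta> / 2 * ?\<mu> * norm s"
  define P where "P = model f x 0 - model f x s"
  have PR: "P \<ge> 0" "R \<ge> 0" using model_decrease_nonneg \<theta> by (auto simp: P_def R_def)
  have "\<eta> \<le> (f x - f (x + s)) / (P + R)"
    using large by (simp add: unicat_ratio_def P_def R_def)
  \<comment> \<open>A vanishing denominator would make the ratio 0, contradicting
    \<open>\<eta> > 0\<close>.\<close>
  with \<eta> PR have "\<eta> * (P + R) \<le> f x - f (x + s)"
    by (cases "P + R = 0") (auto simp: pos_le_divide_eq)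
  moreover have "\<eta> * R \<le> \<eta> * (P + R)" using \<eta> PR by simp
  ultimately have dec: "\<eta> * R \<le> gap x - gap (x + s)" by (simp add: gap_def)
  have "gap x0 powr (- ?p) / 2 * gap x powr (1 + ?p) \<le> gap x - gap (x + s)
    \<or> \<eta> * \<theta> / (4 * D) * c' * gap x powr (1 + ?p) \<le> gap x - gap (x + s)"
  proof (cases "gap x / 2 \<le> gap (x + s)")
    case True
    note grad = small_decrease_gradient[OF True]
    \<comment> \<open>A boundary step has length \<open>\<Delta>\<close>. An interior step has zero
      residual, so the new gradient, which is of order \<open>gap x\<close>, is pure linearization
      error and forces a long step.\<close>
    have "c' * gap x powr ?p \<le> norm s"
    proof (cases "norm s = \<Delta>")
      case True
      have "c' * gap x powr ?p \<le> c * gap x powr ?p" by (intro mult_right_mono) (auto simp: c'_def)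
      then show ?thesis using c True by linarith
    next
      case False
      have "gap x / (2 * D) \<le> L * norm s powr (1 + \<nu>)"
        using grad interior_step[OF False] by simp
      then have "1 / (2 * D * L) * gap x \<le> norm s powr (1 + \<nu>)"
        using L D by (simp add: field_simps)
      then have "(1 / (2 * D * L)) powr ?p * gap x powr ?p \<le> norm s"
        using L D gap \<nu> by (intro powr_inverse_le) auto
      moreover have "c' * gap x powr ?p \<le> (1 / (2 * D * L)) powr ?p * gap x powr ?p"
        by (intro mult_right_mono) (auto simp: c'_def)
      ultimately show ?thesis by linarith
    qed
    then have "gap x / (2 * D) * (c' * gap x powr ?p) \<le> ?\<mu> * norm s"
      using grad gap D c by (intro mult_mono) (auto simp: c'_def)
    then have "\<eta> * (\<theta> / 2) * (gap x / (2 * D) * (c' * gap x powr ?p)) \<le> \<eta> * (\<theta> / 2) * (?\<mu> * norm s)"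
      using \<eta> \<theta> by (intro mult_left_mono) auto
    also have "\<dots> = \<eta> * R" by (simp add: R_def)
    finally show ?thesis using dec gap by (simp add: powr_add mult_ac)
  next
    case False
    have "gap x powr ?p \<le> gap x0 powr ?p" using gap gap_le \<nu> by (intro powr_mono2) auto
    then have "gap x0 powr (- ?p) * gap x powr (1 + ?p) \<le> gap x"
      using gap gap_le by (simp add: powr_add powr_minus field_simps)
    then show ?thesis using False by simp
  qed
  then have "min (gap x0 powr (- ?p) / 2) (\<eta> * \<theta> / (4 * D) * c') * gap x powr (1 + ?p)
    \<le> gap x - gap (x + s)"
    by (elim disjE; elim order_trans[rotated]; intro mult_right_mono) auto
  then show ?thesis by (simp add: c'_def)
qed

end
end
end

section \<open>The complexity bound\<close>

text \<open>The predecessor of the least index violates \<open>P\<close>, which accounts for the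
  added 1.\<close>

lemma Least_le_bound:
  fixes P :: "nat \<Rightarrow> bool" and B :: real
  assumes "B \<ge> 0" and bound: "\<And>k. \<not> P k \<Longrightarrow> real k \<le> B"
  shows "(\<exists>k. P k) \<and> real (LEAST k. P k) \<le> B + 1"
proof
  show "\<exists>k. P k"
    using bound by (meson linorder_not_le reals_Archimedean2)
  show "real (LEAST k. P k) \<le> B + 1"
  proof (cases "LEAST k. P k")
    case 0
    then show ?thesis using assms(1) by simp
  next
    case (Suc n)
    then have "\<not> P n" by (intro not_less_Least) simp
    then show ?thesis using bound[of n] Suc by simp
  qed
qed

theorem theorem20:
  fixes f :: "'a::euclidean_space \<Rightarrow> real"
    and x0 :: 'a
    and L \<nu> \<Delta>0 \<theta> \<eta>1 \<eta>2 \<gamma>1 \<gamma>2 \<gamma>3 :: real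
  assumes "convex_on UNIV f"
    and "twice_cont_diff f"
    and "bdd_below (range f)"
    and "minimizers f \<noteq> {}"
    and "L > 0" and "0 \<le> \<nu>" and "\<nu> \<le> 1"
    and "\<forall>x y. norm (hessian f x - hessian f y) \<le> L * norm (x - y) powr \<nu>"
    and "bdd_above ((\<lambda>x. infdist x (minimizers f)) ` {x. f x \<le> f x0})"
    and "\<Delta>0 > 0" and "\<theta> > 0"
    and "0 < \<eta>1" and "\<eta>1 \<le> \<eta>2" and "\<eta>2 < 1"
    and "0 < \<gamma>1" and "\<gamma>1 \<le> \<gamma>2" and "\<gamma>2 < 1" and "1 \<le> \<gamma>3"
    and "\<eta>2 < 1 / (1 + \<theta> / 2)"
  shows "\<exists>C>0. \<exists>\<epsilon>0>0. \<forall>x s \<Delta>.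
    unicat_run f x0 \<Delta>0 \<theta> \<eta>1 \<eta>2 \<gamma>1 \<gamma>2 \<gamma>3 x s \<Delta> \<longrightarrow>
    (\<forall>k. norm (gradient f (x k)) > 0 \<and> f (x k) - min_value f > 0) \<longrightarrow>
    (\<forall>\<epsilon>. 0 < \<epsilon> \<and> \<epsilon> \<le> \<epsilon>0 \<longrightarrow>
      (\<exists>k. f (x k) - min_value f \<le> \<epsilon>) \<and>
      real (k_cat f x \<epsilon>) \<le> C * \<epsilon> powr (- (1 / (1 + \<nu>))))"
proof (cases "f x0 - min_value f > 0")
  \<comment> \<open>The positivity assumption fails at index 0, so any constants will do.\<close>
  case False
  have "x 0 = x0" if "unicat_run f x0 \<Delta>0 \<theta> \<eta>1 \<eta>2 \<gamma>1 \<gamma>2 \<gamma>3 x s \<Delta>" for x s \<Delta>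
    using that by (simp add: unicat_run_def)
  with False show ?thesis by (metis zero_less_one)
next
  case True
  obtain B where B: "\<And>z. f z \<le> f x0 \<Longrightarrow> infdist z (minimizers f) \<le> B"
    using assms(9) by (auto simp: bdd_above_def)
  \<comment> \<open>The maximum with 1 makes \<open>D\<close> positive, so that it can be divided
    by, even if \<open>B\<close> is 0.\<close>
  define D where "D = max 1 B"
  interpret holder_convex f L \<nu> D x0
  proof
    show "infdist z (minimizers f) \<le> D" if "f z \<le> f x0" for z
      using B[OF that] by (simp add: D_def)
  qed (use assms in \<open>auto simp: D_def\<close>)
  define p where "p = 1 / (1 + \<nu>)"
  define \<delta> where "\<delta> = (1 - \<eta>2 * (1 + \<theta> / 2)) / 2"
  define K where "K = (1 + \<theta> / (2 * \<delta>)) / (1 - \<eta>2) + \<theta> / (2 * \<delta>)"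
  define c0 where "c0 = min ((\<delta> / (2 * D * L)) powr p)
    ((gap x0 powr (- p) / (2 * K * L)) powr (1 / (2 + \<nu>)))"
  \<comment> \<open>The first entry makes the radius bound true initially; the second allows for one
    reduction by \<open>\<gamma>1\<close> from a radius of at least
    \<open>c0 * gap (x k) powr p\<close>. None of these constants depends on the run.\<close>
  define c where "c = min (\<Delta>0 / gap x0 powr p) (\<gamma>1 * c0)"
  define c1 where "c1 = min (gap x0 powr (- p) / 2)
    (\<eta>1 * \<theta> / (4 * D) * min c ((1 / (2 * D * L)) powr p))"
  define b where "b = 1 / ln (1 / \<gamma>2)"
  define a where "a = (1 + b * ln \<gamma>3) / (p * c1)"
  define M where "M = b * (ln \<Delta>0 - ln c)"
  have \<eta>2: "0 < \<eta>2" "\<eta>2 < 1" and \<gamma>2: "0 < \<gamma>2" "\<gamma>2 < 1" using assms by auto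
  have p: "p > 0" using \<nu> by (simp add: p_def)
  have \<delta>: "2 * \<delta> = 1 - \<eta>2 * (1 + \<theta> / 2)" "\<delta> > 0"
    using assms(11,19) by (auto simp: \<delta>_def pos_less_divide_eq)
  have "K > 0"
    unfolding K_def using \<eta>2 \<delta>(2) assms(11) by (intro add_pos_pos divide_pos_pos) auto
  then have "c0 > 0" using \<delta>(2) D L True by (auto simp: c0_def gap_def)
  then have c: "c > 0" using assms(10,15) True by (auto simp: c_def gap_def)
  then have c1: "c1 > 0" using assms(11,12) D L True by (auto simp: c1_def gap_def)
  have b: "b > 0" using \<gamma>2 by (simp add: b_def)
  have a: "a > 0" using b assms(18) p c1 by (simp add: a_def add_pos_nonneg)
  have bound: "real k \<le> (a + b) * gap (x k) powr (- p) + M"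
    if run: "unicat_run f x0 \<Delta>0 \<theta> \<eta>1 \<eta>2 \<gamma>1 \<gamma>2 \<gamma>3 x s \<Delta>"
      and pos: "\<And>k. gap (x k) > 0" for x s \<Delta> k
  proof -
    let ?\<rho> = "\<lambda>k. unicat_ratio \<theta> f (x k) (s k)"
    have x0: "x 0 = x0" and \<Delta>0: "\<Delta> 0 = \<Delta>0"
      and opt: "is_arg_min (model f (x k)) (\<lambda>t. norm t \<le> \<Delta> k) (s k)"
      and x_Suc: "x (Suc k) = (if ?\<rho> k \<ge> \<eta>1 then x k + s k else x k)"
      and \<Delta>_fail: "?\<rho> k < \<eta>1 \<Longrightarrow> \<Delta> (Suc k) \<in> {\<gamma>1 * \<Delta> k .. \<gamma>2 * \<Delta> k}"
      and \<Delta>_good: "\<eta>1 \<le> ?\<rho> k \<Longrightarrow> ?\<rho> k < \<eta>2 \<Longrightarrow> \<Delta> (Suc k) \<in> {\<gamma>2 * \<Delta> k .. \<Delta> k}"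
      and \<Delta>_very_good: "?\<rho> k \<ge> \<eta>2 \<Longrightarrow> \<Delta> (Suc k) \<in> {\<Delta> k .. \<gamma>3 * \<Delta> k}" for k
      using run by (auto simp: unicat_run_def Let_def)
    have \<Delta>_pos: "\<Delta> k > 0" if "c * gap (x k) powr p \<le> \<Delta> k" for k
    proof -
      have "0 < c * gap (x k) powr p" using c pos[of k] by simp
      then show ?thesis using that by linarith
    qed
    have descent: "gap (x (Suc k)) \<le> gap (x k) - c1 * gap (x k) powr (1 + p)"
      if "f (x k) \<le> f x0" "c * gap (x k) powr p \<le> \<Delta> k" "?\<rho> k \<ge> \<eta>1" for k
      using successful_decrease[OF opt \<Delta>_pos pos that(1) assms(11,12) that(3) _ c] that x_Suc[of k]
      by (simp add: c1_def p_def)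
    \<comment> \<open>The two claims need a joint induction: the gradient estimates require the
      level set, and descent requires the radius bound.\<close>
    have inv: "f (x k) \<le> f x0 \<and> c * gap (x k) powr p \<le> \<Delta> k" for k
    proof (induction k)
      case 0
      have "c * gap x0 powr p \<le> \<Delta>0 / gap x0 powr p * gap x0 powr p"
        by (intro mult_right_mono) (auto simp: c_def)
      then show ?case using True by (simp add: x0 \<Delta>0 gap_def)
    next
      case (Suc k)
      then have lev: "f (x k) \<le> f x0" and low: "c * gap (x k) powr p \<le> \<Delta> k" by auto
      note \<Delta>k = \<Delta>_pos[OF low]
      have mono: "gap (x (Suc k)) \<le> gap (x k)"
      proof (cases "?\<rho> k \<ge> \<eta>1")
        case True
        moreover have "c1 * gap (x k) powr (1 + p) \<ge> 0" using c1 by simp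
        ultimately show ?thesis using descent[OF lev low] by linarith
      qed (simp add: x_Suc)
      then have "gap (x (Suc k)) powr p \<le> gap (x k) powr p"
        using p pos[of "Suc k"] by (intro powr_mono2) auto
      then have "c * gap (x (Suc k)) powr p \<le> c * gap (x k) powr p" using c by simp
      also have "\<dots> \<le> \<Delta> (Suc k)"
      proof (cases "?\<rho> k < \<eta>2")
        \<comment> \<open>The threshold is \<open>\<eta>2\<close>, since accepted steps with a ratio
          below it may also shrink the radius. In both cases the old radius is at least the step
          length and shrinks by a factor of at least \<open>\<gamma>1\<close>.\<close>
        case True
        have "c0 * gap (x k) powr p \<le> norm (s k)"
          unfolding c0_def p_def
          by (rule small_ratio_step_norm[OF opt \<Delta>k pos lev assms(11) \<eta>2 \<delta> K_def True])
        also have "\<dots> \<le> \<Delta> k" by (rule step_in_ball[OF opt \<Delta>k])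
        finally have "\<gamma>1 * (c0 * gap (x k) powr p) \<le> \<gamma>1 * \<Delta> k" using assms(15) by simp
        moreover have "c * gap (x k) powr p \<le> \<gamma>1 * c0 * gap (x k) powr p"
          by (intro mult_right_mono) (auto simp: c_def)
        moreover have "\<gamma>1 * \<Delta> k \<le> \<gamma>2 * \<Delta> k" using assms(16) \<Delta>k by simp
        moreover have "\<gamma>1 * \<Delta> k \<le> \<Delta> (Suc k) \<or> \<gamma>2 * \<Delta> k \<le> \<Delta> (Suc k)"
          using \<Delta>_fail[of k] \<Delta>_good[of k] True by fastforce
        ultimately show ?thesis by (simp add: mult.assoc) linarith
      next
        case False
        then show ?thesis using \<Delta>_very_good[of k] low by simp
      qed
      finally show ?case using mono lev by (simp add: gap_def)
    qed
    have step: "gap (x (Suc k)) \<le> gap (x k) - c1 * gap (x k) powr (1 + p) \<and> \<Delta> (Suc k) \<le> \<gamma>3 * \<Delta> k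
      \<or> gap (x (Suc k)) = gap (x k) \<and> \<Delta> (Suc k) \<le> \<gamma>2 * \<Delta> k" for k
    proof (cases "?\<rho> k \<ge> \<eta>1")
      case True
      have "\<Delta> k \<le> \<gamma>3 * \<Delta> k" using assms(18) \<Delta>_pos[of k] inv[of k] by simp
      then have "\<Delta> (Suc k) \<le> \<gamma>3 * \<Delta> k"
        using True \<Delta>_good[of k] \<Delta>_very_good[of k] by fastforce
      then show ?thesis using descent[of k] inv[of k] True by blast
    next
      case False
      then show ?thesis using \<Delta>_fail[of k] by (simp add: x_Suc)
    qed
    have lower: "c * gap (x k) powr p \<le> \<Delta> k" for k using inv by blast
    show ?thesis
      using iteration_count[where d = "\<lambda>k. gap (x k)" and \<Delta> = \<Delta>, OF pos p c c1 \<gamma>2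
          assms(18) lower step b_def a_def, of k]
      by (simp add: M_def \<Delta>0)
  qed
  define C where "C = a + b + \<bar>M\<bar> + 1"
  have "(\<exists>k. f (x k) - min_value f \<le> \<epsilon>) \<and> real (k_cat f x \<epsilon>) \<le> C * \<epsilon> powr (- p)"
    if run: "unicat_run f x0 \<Delta>0 \<theta> \<eta>1 \<eta>2 \<gamma>1 \<gamma>2 \<gamma>3 x s \<Delta>"
      and pos: "\<And>k. gap (x k) > 0" and \<epsilon>: "0 < \<epsilon>" "\<epsilon> \<le> 1" for x s \<Delta> \<epsilon>
  proof -
    let ?B = "(a + b) * \<epsilon> powr (- p) + \<bar>M\<bar>"
    have "real k \<le> ?B" if "\<not> f (x k) - min_value f \<le> \<epsilon>" for k
    proof -
      have "gap (x k) powr (- p) \<le> \<epsilon> powr (- p)"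
        using that \<epsilon> p by (intro powr_mono2') (auto simp: gap_def)
      then have "(a + b) * gap (x k) powr (- p) \<le> (a + b) * \<epsilon> powr (- p)" using a b by simp
      then show ?thesis using bound[OF run pos, of k] by linarith
    qed
    then have "(\<exists>k. f (x k) - min_value f \<le> \<epsilon>) \<and> real (k_cat f x \<epsilon>) \<le> ?B + 1"
      unfolding k_cat_def using a b by (intro Least_le_bound) auto
    \<comment> \<open>This is where \<open>\<epsilon> \<le> 1\<close> enters: the additive constants
      are absorbed into \<open>C\<close>.\<close>
    moreover have "1 \<le> \<epsilon> powr (- p)"
      using powr_mono2'[of "- p" \<epsilon> 1] \<epsilon> p by simp
    then have "(\<bar>M\<bar> + 1) * 1 \<le> (\<bar>M\<bar> + 1) * \<epsilon> powr (- p)" by (intro mult_left_mono) auto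
    then have "?B + 1 \<le> C * \<epsilon> powr (- p)" by (simp add: C_def algebra_simps)
    ultimately show ?thesis by (blast intro: order_trans)
  qed
  moreover have "C > 0" using a b by (simp add: C_def)
  ultimately show ?thesis
    unfolding p_def gap_def by (intro exI[of _ C] conjI exI[of _ "1::real"]) auto
qed

end
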